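(* Let $G$ be a strongly connected directed graph on $n$ nodes and $P$ a column stochastic protocol on $G$. If Push-Sum is run on $G$ using $P$ in the presence of time-varying delays bounded by $B\ge1$, modelled by the matrices $\widehat P(t)$, then average consensus is achieved at a geometric rate. That is, for every initial vector $x(0)\in\mathbb R^n$, with $$\widehat s(0)=\begin{bmatrix}x(0)\\ \mathbf 0_b\end{bmatrix},\quad \widehat w(0)=\begin{bmatrix}\mathbf 1_n\\ \mathbf 0_b\end{bmatrix},\quad \widehat s(t)=\widehat P(t)\widehat s(t-1),\quad \widehat w(t)=\widehat P(t)\widehat w(t-1)\quad(t\ge1),$$ the estimates $x_i(t)=\widehat s_i(t)/\widehat w_i(t)$ at the compute nodes $1\le i\le n$ converge to $x_{ave}=\frac1n\sum_{j=1}^nx_j(0)$ geometrically: there exist $C_0\ge0$ and $\rho\in(0,1)$ with $|x_i(t)-x_{ave}|\le C_0\rho^t$ for all $t\ge0$ and all $1\le i\le n$.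
   Context: Protocol: $P=(p_{ij})$ is an $n\times n$ nonnegative column stochastic matrix respecting $G=(V,E)$: for $i\ne j$, $p_{ij}>0$ iff $(j,i)\in E$ (i.e. $j$ sends to $i$; $p_{ij}$ is the share $j$ sends to $i$), and every node has a self-loop, $p_{ii}>0$. Let $m$ be the number of directed edges, not counting self-loops. Random delay model for Push-Sum: for each directed edge $e=(j,i)$, $j\ne i$, and each $\ell=1,\dots,B$ there is a chain of virtual delay nodes $d^\ell_1(e),\dots,d^\ell_\ell(e)$; in total $b=mB(B+1)/2$ delay nodes, indexed after the compute nodes $1,\dots,n$. At each iteration $t\ge1$ the message sent over edge $e$ experiences a (random, time-varying) delay $\tau_e(t)\in\{0,\dots,B\}$. Define: - $L(t)\in\{0,1\}^{n\times n}$: $L_{ij}(t)=1$ iff $e=(j,i)$ is an edge, $i\ne j$, and $\tau_e(t)=0$; $P\circ L(t)$ is the entrywise product. - $\operatorname{diag}(P)$: the diagonal matrix with the diagonal entries of $P$. - $\bar P[R(t)]\in\mathbb R^{b\times n}$: the $(d,j)$ entry is $p_{ij}$ if $d=d^\ell_1(e)$ for an edge $e=(j,i)$ with $\tau_e(t)=\ell\ge1$, and $0$ otherwise. - $J\in\{0,1\}^{n\times b}$: $J_{i,d}=1$ iff $d=d^\ell_\ell(e)$ for some edge $e=(j,i)$ and some $\ell$. - $C\in\{0,1\}^{b\times b}$: $C_{d',d}=1$ iff $d=d^\ell_k(e)$ and $d'=d^\ell_{k+1}(e)$ for some $e,\ell,k$. $$\widehat P(t)=\begin{bmatrix}\operatorname{diag}(P)+P\circ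 L(t)&J\\ \bar P[R(t)]&C\end{bmatrix},$$ which is column stochastic. The statement is a worst-case one: it concerns every realization of the delays. *)

theory Defs
  imports
    Complex_Main
    "Jordan_Normal_Form.Matrix"
    "Graph_Theory.Pair_Digraph"
    "Graph_Theory.Digraph_Component"
begin

text \<open>
  The \<open>n\<close> compute nodes are numbered \<open>0, \<dots>, n - 1\<close>, matching the index range of matrices and vectors.
  An arc \<open>(j, i)\<close> means that \<open>j\<close> sends to \<open>i\<close>.
\<close>

subsection \<open>Protocols\<close>

definition column_stochastic :: "real mat \<Rightarrow> bool" where
  "column_stochastic A \<longleftrightarrow>
     (\<forall>i<dim_row A. \<forall>j<dim_col A. A $$ (i, j) \<ge> 0) \<and>
     (\<forall>j<dim_col A. (\<Sum>i<dim_row A. A $$ (i, j)) = 1)"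

text \<open>
  Only the positive diagonal encodes that every node keeps a share for itself: the arc set of \<open>G\<close>
  may, but need not, contain the arcs \<open>(i, i)\<close>.
\<close>

definition respects_graph :: "nat \<Rightarrow> real mat \<Rightarrow> nat pair_pre_digraph \<Rightarrow> bool" where
  "respects_graph n P G \<longleftrightarrow>
     (\<forall>i<n. \<forall>j<n. i \<noteq> j \<longrightarrow> (P $$ (i, j) > 0 \<longleftrightarrow> (j, i) \<in> parcs G)) \<and>
     (\<forall>i<n. P $$ (i, i) > 0)"

definition column_stochastic_protocol :: "nat \<Rightarrow> real mat \<Rightarrow> nat pair_pre_digraph \<Rightarrow> bool" where
  "column_stochastic_protocol n P G \<longleftrightarrow>
     P \<in> carrier_mat n n \<and> column_stochastic P \<and> respects_graph n P G"

subsection \<open>Delay nodes\<close>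

definition links :: "nat pair_pre_digraph \<Rightarrow> (nat \<times> nat) set" where
  "links G = {(j, i). (j, i) \<in> parcs G \<and> j \<noteq> i}"

text \<open>\<open>Delay e l k\<close> is the \<open>k\<close>-th node of the chain of length \<open>l\<close> attached to the arc \<open>e\<close>.\<close>

datatype delay_node = Delay "nat \<times> nat" nat nat

definition delay_nodes :: "nat pair_pre_digraph \<Rightarrow> nat \<Rightarrow> delay_node set" where
  "delay_nodes G B = {Delay e l k | e l k. e \<in> links G \<and> 1 \<le> l \<and> l \<le> B \<and> 1 \<le> k \<and> k \<le> l}"

definition num_delay_nodes :: "nat pair_pre_digraph \<Rightarrow> nat \<Rightarrow> nat" where
  "num_delay_nodes G B = card (links G) * B * (B + 1) div 2"

text \<open>
  The matrices below refer to delay nodes through an enumeration \<open>d\<close>, a bijection from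
  \<open>{..<num_delay_nodes G B}\<close> onto \<open>delay_nodes G B\<close>. Such an enumeration always exists.
\<close>

lemma card_delay_nodes:
  assumes "finite (links G)"
  shows "card (delay_nodes G B) = num_delay_nodes G B"
proof -
  let ?S = "links G \<times> (SIGMA l:{1..B}. {1..l})"
  have "delay_nodes G B = (\<lambda>(e, l, k). Delay e l k) ` ?S"
    unfolding delay_nodes_def by force
  moreover have "inj_on (\<lambda>(e, l, k). Delay e l k) ?S"
    by (auto simp: inj_on_def)
  ultimately have "card (delay_nodes G B) = card ?S"
    by (simp add: card_image)
  also have "\<dots> = card (links G) * (\<Sum>l=1..B. l)"
    by (simp add: card_cartesian_product)
  also have "2 * \<dots> = card (links G) * B * (B + 1)"
    by (induction B) (auto simp: algebra_simps)
  hence "card (links G) * (\<Sum>l=1..B. l) = num_delay_nodes G B"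
    unfolding num_delay_nodes_def by linarith
  finally show ?thesis .
qed

lemma ex_delay_enumeration:
  assumes "finite (parcs G)"
  shows "\<exists>d. bij_betw d {..<num_delay_nodes G B} (delay_nodes G B)"
proof -
  have fin: "finite (links G)"
    by (rule finite_subset[OF _ assms]) (auto simp: links_def)
  have "delay_nodes G B \<subseteq> (\<lambda>(e, l, k). Delay e l k) ` (links G \<times> {..B} \<times> {..B})"
    unfolding delay_nodes_def by force
  hence "finite (delay_nodes G B)"
    using fin by (meson finite_SigmaI finite_atMost finite_imageI finite_subset)
  from ex_bij_betw_nat_finite[OF this] show ?thesis
    by (simp add: card_delay_nodes[OF fin] atLeast0LessThan)
qed

subsection \<open>The delayed iteration\<close>

text \<open>
  In the following, \<open>\<tau> e\<close> is the delay experienced by the message sent over \<open>e\<close> in the iteration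
  under consideration.
\<close>

definition entrywise_prod :: "real mat \<Rightarrow> real mat \<Rightarrow> real mat" where
  "entrywise_prod A A' = mat (dim_row A) (dim_col A) (\<lambda>(i, j). A $$ (i, j) * A' $$ (i, j))"

definition undelayed_mat :: "nat \<Rightarrow> nat pair_pre_digraph \<Rightarrow> (nat \<times> nat \<Rightarrow> nat) \<Rightarrow> real mat" where
  "undelayed_mat n G \<tau> = mat n n (\<lambda>(i, j). if (j, i) \<in> links G \<and> \<tau> (j, i) = 0 then 1 else 0)"

definition entry_mat ::
  "nat \<Rightarrow> nat \<Rightarrow> real mat \<Rightarrow> (nat \<Rightarrow> delay_node) \<Rightarrow> (nat \<times> nat \<Rightarrow> nat) \<Rightarrow> real mat" where
  "entry_mat n b P d \<tau> = mat b n (\<lambda>(r, j). case d r of Delay (j', i) l k \<Rightarrow>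
     if j' = j \<and> k = 1 \<and> \<tau> (j', i) = l \<and> l \<ge> 1 then P $$ (i, j) else 0)"

definition exit_mat :: "nat \<Rightarrow> nat \<Rightarrow> (nat \<Rightarrow> delay_node) \<Rightarrow> real mat" where
  "exit_mat n b d = mat n b (\<lambda>(i, r). case d r of Delay (j, i') l k \<Rightarrow>
     if i' = i \<and> k = l then 1 else 0)"

definition chain_mat :: "nat \<Rightarrow> (nat \<Rightarrow> delay_node) \<Rightarrow> real mat" where
  "chain_mat b d = mat b b (\<lambda>(r', r). case (d r', d r) of (Delay e' l' k', Delay e l k) \<Rightarrow>
     if e' = e \<and> l' = l \<and> k' = k + 1 then 1 else 0)"

definition delay_mat ::
  "nat \<Rightarrow> nat pair_pre_digraph \<Rightarrow> real mat \<Rightarrow> nat \<Rightarrow> (nat \<Rightarrow> delay_node) \<Rightarrow> (nat \<times> nat \<Rightarrow> nat) \<Rightarrow> real mat"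
where
  "delay_mat n G P B d \<tau> = (let b = num_delay_nodes G B in
     four_block_mat
       (mat_diag n (\<lambda>i. P $$ (i, i)) + entrywise_prod P (undelayed_mat n G \<tau>)) (exit_mat n b d)
       (entry_mat n b P d \<tau>)                                                 (chain_mat b d))"

text \<open>The first matrix applied is \<open>A 1\<close>; the value \<open>A 0\<close> is irrelevant.\<close>

fun iterate :: "(nat \<Rightarrow> real mat) \<Rightarrow> real vec \<Rightarrow> nat \<Rightarrow> real vec" where
  "iterate A v 0 = v"
| "iterate A v (Suc t) = A (Suc t) *\<^sub>v iterate A v t"

definition estimate :: "nat \<Rightarrow> nat \<Rightarrow> (nat \<Rightarrow> real mat) \<Rightarrow> real vec \<Rightarrow> nat \<Rightarrow> nat \<Rightarrow> real" where
  "estimate n b A x0 t i =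
     iterate A (x0 @\<^sub>v 0\<^sub>v b) t $ i / iterate A (vec n (\<lambda>_. 1) @\<^sub>v 0\<^sub>v b) t $ i"

end

theory Submission
  imports Defs
begin

text \<open>
  Write \<open>z = s - a w\<close>, where \<open>a\<close> is the average, and suppose \<open>\<bar>z\<bar> \<le> D w\<close> at some time.
  Both \<open>D w + z\<close> and \<open>D w - z\<close> are nonnegative and have the same total mass as \<open>D w\<close>.
  By strong connectivity, self-loops and the delay bound, after a fixed number of steps every compute
  node holds at least a fixed fraction of the total mass of any nonnegative state. Delay nodes only
  carry mass proportional to what a compute node held a few steps before, with the same factor for
  all states. Hence
  \<open>D w \<plusminus> z \<ge> \<delta> D w\<close> after a fixed number of steps, so the bound \<open>D\<close> shrinks by the factor
  \<open>1 - \<delta>\<close>.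
\<close>

section \<open>Splitting sums at the compute nodes, and geometric rates\<close>

lemma sum_lessThan_add:
  fixes f :: "nat \<Rightarrow> real"
  shows "(\<Sum>v<m + k. f v) = (\<Sum>v<m. f v) + (\<Sum>r<k. f (m + r))"
  by (induction k) simp_all

text \<open>Turns a decay by \<open>q\<close> per block of \<open>T\<close> steps into a rate per
  step, namely the \<open>T\<close>-th root of \<open>q\<close>. The factor \<open>1 / q\<close>
  pays for the last, incomplete block.\<close>

lemma div_power_le_geometric:
  fixes q :: real
  assumes "0 < q" "q < 1" "T \<ge> 1"
  obtains C \<rho> where "C \<ge> 0" "0 < \<rho>" "\<rho> < 1" "\<And>t. q ^ (t div T) \<le> C * \<rho> ^ t"
proof
  let ?\<rho> = "root T q"
  show "1 / q \<ge> 0" "0 < ?\<rho>" "?\<rho> < 1"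
    using assms by simp_all
  fix t
  have "q * q ^ (t div T) = ?\<rho> ^ T * (?\<rho> ^ T) ^ (t div T)"
    using assms by (simp add: real_root_pow_pos)
  also have "\<dots> = ?\<rho> ^ (T + T * (t div T))"
    by (simp add: power_add power_mult)
  also have "\<dots> \<le> ?\<rho> ^ t"
  proof (rule power_decreasing)
    have "t mod T < T" using assms by simp
    then show "t \<le> T + T * (t div T)"
      using mult_div_mod_eq[of T t] by linarith
  qed (use assms in simp_all)
  finally show "q ^ (t div T) \<le> 1 / q * ?\<rho> ^ t"
    using assms by (simp add: field_simps)
qed

section \<open>The network, its protocol and the numbering of the delay nodes\<close>

locale delayed_push_sum =
  fixes n B :: nat
    and G :: "nat pair_pre_digraph"
    and P :: "real mat"
    and d :: "nat \<Rightarrow> delay_node"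
    and \<tau> :: "nat \<Rightarrow> nat \<times> nat \<Rightarrow> nat"
  assumes fin_digraph: "pair_fin_digraph G"
    and verts: "pverts G = {..<n}"
    and connected: "strongly_connected (with_proj G)"
    and protocol: "column_stochastic_protocol n P G"
    and delay_enum: "bij_betw d {..<num_delay_nodes G B} (delay_nodes G B)"
    and delay_bound: "\<And>t e. t \<ge> 1 \<Longrightarrow> e \<in> links G \<Longrightarrow> \<tau> t e \<le> B"
begin

abbreviation "b \<equiv> num_delay_nodes G B"
abbreviation "N \<equiv> n + b"

text \<open>Time is shifted by one: \<open>kernel t\<close> leads from time \<open>t\<close> to time
  \<open>Suc t\<close>, and the first matrix applied is the one of iteration 1. The arguments are
  ordered as in the matrix, receiver before sender.\<close>

definition kernel :: "nat \<Rightarrow> nat \<Rightarrow> nat \<Rightarrow> real" where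
  "kernel t v u = delay_mat n G P B d (\<tau> (Suc t)) $$ (v, u)"

definition index :: "delay_node \<Rightarrow> nat" where
  "index x = n + inv_into {..<b} d x"

lemma n_pos: "n > 0"
  using connected verts by (auto simp: strongly_connected_def)

lemma link_verts: "(j, i) \<in> links G \<Longrightarrow> j < n \<and> i < n \<and> j \<noteq> i"
proof -
  interpret pair_fin_digraph G by (rule fin_digraph)
  show "(j, i) \<in> links G \<Longrightarrow> j < n \<and> i < n \<and> j \<noteq> i"
    using in_arcsD1 in_arcsD2 verts by (auto simp: links_def)
qed

lemma P_dims: "dim_row P = n" "dim_col P = n"
  using protocol by (auto simp: column_stochastic_protocol_def)

lemma P_nonneg: "i < n \<Longrightarrow> j < n \<Longrightarrow> P $$ (i, j) \<ge> 0"
  and P_column_sum: "j < n \<Longrightarrow> (\<Sum>i<n. P $$ (i, j)) = 1"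
  using protocol by (auto simp: column_stochastic_protocol_def column_stochastic_def)

lemma P_diag_pos: "i < n \<Longrightarrow> P $$ (i, i) > 0"
  using protocol by (simp add: column_stochastic_protocol_def respects_graph_def)

lemma P_pos_iff_link:
  "i < n \<Longrightarrow> j < n \<Longrightarrow> i \<noteq> j \<Longrightarrow> P $$ (i, j) > 0 \<longleftrightarrow> (j, i) \<in> links G"
  using protocol by (auto simp: column_stochastic_protocol_def respects_graph_def links_def)

lemma P_link_pos: "(j, i) \<in> links G \<Longrightarrow> P $$ (i, j) > 0"
  using P_pos_iff_link link_verts by blast

lemma P_not_link: "i < n \<Longrightarrow> j < n \<Longrightarrow> i \<noteq> j \<Longrightarrow> (j, i) \<notin> links G \<Longrightarrow> P $$ (i, j) = 0"
  using P_pos_iff_link[of i j] P_nonneg[of i j] by linarith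

lemma index_props:
  assumes "x \<in> delay_nodes G B"
  shows "index x < N" "n \<le> index x" "d (index x - n) = x"
proof -
  have "inv_into {..<b} d x \<in> {..<b}"
    using assms delay_enum by (metis bij_betw_imp_surj_on inv_into_into)
  then show "index x < N" "n \<le> index x"
    by (simp_all add: index_def)
  show "d (index x - n) = x"
    using assms delay_enum by (simp add: index_def bij_betw_inv_into_right)
qed

lemma d_in_delay_nodes: "r < b \<Longrightarrow> d r \<in> delay_nodes G B"
  using delay_enum by (auto simp: bij_betw_def)

lemma index_d: "r < b \<Longrightarrow> index (d r) = n + r"
  using delay_enum by (simp add: index_def bij_betw_inv_into_left)

lemma sum_delay_nodes: "(\<Sum>r<b. f (d r)) = sum f (delay_nodes G B)"
  by (rule sum.reindex_bij_betw[OF delay_enum])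

lemma finite_delay_nodes: "finite (delay_nodes G B)"
  using delay_enum by (metis bij_betw_finite finite_lessThan)

lemma Delay_in_delay_nodes [simp]:
  "Delay e l k \<in> delay_nodes G B \<longleftrightarrow> e \<in> links G \<and> l \<le> B \<and> 1 \<le> k \<and> k \<le> l"
  by (cases e) (auto simp: delay_nodes_def)

lemma node_cases:
  assumes "v < N"
  obtains "v < n"
  | j i l k where "Delay (j, i) l k \<in> delay_nodes G B" "v = index (Delay (j, i) l k)"
proof (cases "v < n")
  case False
  then have r: "v - n < b" using assms by simp
  obtain j i l k where "d (v - n) = Delay (j, i) l k"
    by (metis delay_node.exhaust prod.exhaust)
  with d_in_delay_nodes[OF r] index_d[OF r] False that(2)[of j i l k] show ?thesis
    by simp
qed (use that in blast)

section \<open>Entries of the delay matrices and column stochasticity\<close>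

lemma delay_mat_dims: "delay_mat n G P B d \<theta> \<in> carrier_mat N N"
  by (simp add: delay_mat_def Let_def entry_mat_def exit_mat_def chain_mat_def
      entrywise_prod_def P_dims mat_diag_def)

lemma kernel_compute_compute:
  "v < n \<Longrightarrow> u < n \<Longrightarrow> kernel t v u =
     (if u = v then P $$ (v, v)
      else if (u, v) \<in> links G \<and> \<tau> (Suc t) (u, v) = 0 then P $$ (v, u) else 0)"
  by (auto simp: kernel_def delay_mat_def Let_def entry_mat_def exit_mat_def chain_mat_def
      entrywise_prod_def undelayed_mat_def P_dims mat_diag_def dest: link_verts)

lemma kernel_compute_delay:
  "v < n \<Longrightarrow> r < b \<Longrightarrow> kernel t v (n + r) =
     (case d r of Delay (j, i) l k \<Rightarrow> if i = v \<and> k = l then 1 else 0)"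
  by (auto simp: kernel_def delay_mat_def Let_def entry_mat_def exit_mat_def chain_mat_def
      entrywise_prod_def undelayed_mat_def P_dims mat_diag_def)

lemma kernel_delay_compute:
  "r < b \<Longrightarrow> u < n \<Longrightarrow> kernel t (n + r) u =
     (case d r of Delay (j, i) l k \<Rightarrow>
        if j = u \<and> k = 1 \<and> \<tau> (Suc t) (j, i) = l \<and> l \<ge> 1 then P $$ (i, u) else 0)"
  by (auto simp: kernel_def delay_mat_def Let_def entry_mat_def exit_mat_def chain_mat_def
      entrywise_prod_def undelayed_mat_def P_dims mat_diag_def)

lemma kernel_delay_delay:
  "r' < b \<Longrightarrow> r < b \<Longrightarrow> kernel t (n + r') (n + r) =
     (case (d r', d r) of (Delay e' l' k', Delay e l k) \<Rightarrow>
        if e' = e \<and> l' = l \<and> k' = k + 1 then 1 else 0)"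
  by (auto simp: kernel_def delay_mat_def Let_def entry_mat_def exit_mat_def chain_mat_def
      entrywise_prod_def undelayed_mat_def P_dims mat_diag_def)

text \<open>Describes the row of a delay node. It has at most one nonzero entry: the head of a chain
  is fed only by the sender of its link, every later node only by its predecessor.\<close>

lemma kernel_to_index:
  assumes "Delay (j, i) l k \<in> delay_nodes G B"
  shows "u < n \<Longrightarrow> kernel t (index (Delay (j, i) l k)) u =
           (if j = u \<and> k = 1 \<and> \<tau> (Suc t) (j, i) = l then P $$ (i, u) else 0)"
    and "r < b \<Longrightarrow> kernel t (index (Delay (j, i) l k)) (n + r) =
           (if k \<ge> 2 \<and> d r = Delay (j, i) l (k - 1) then 1 else 0)"
proof -
  define r' where "r' = index (Delay (j, i) l k) - n"
  have r': "r' < b" "d r' = Delay (j, i) l k" "index (Delay (j, i) l k) = n + r'"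
    using index_props[OF assms] by (auto simp: r'_def)
  show "u < n \<Longrightarrow> kernel t (index (Delay (j, i) l k)) u =
           (if j = u \<and> k = 1 \<and> \<tau> (Suc t) (j, i) = l then P $$ (i, u) else 0)"
    using assms r' by (auto simp: kernel_delay_compute)
  show "kernel t (index (Delay (j, i) l k)) (n + r) =
           (if k \<ge> 2 \<and> d r = Delay (j, i) l (k - 1) then 1 else 0)" if r: "r < b"
    using assms r' r d_in_delay_nodes[OF r]
    by (cases "d r") (auto simp: kernel_delay_delay)
qed

lemma kernel_nonneg:
  assumes "v < N" "u < N"
  shows "kernel t v u \<ge> 0"
proof (cases "v < n")
  case v: True
  show ?thesis
  proof (cases "u < n")
    case True
    then show ?thesis using v P_nonneg by (auto simp: kernel_compute_compute)
  next
    case False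
    then have "u = n + (u - n)" "u - n < b" using assms by auto
    then show ?thesis using v kernel_compute_delay[of v "u - n" t]
      by (auto split: delay_node.splits prod.splits)
  qed
next
  case False
  with assms obtain j i l k where x: "Delay (j, i) l k \<in> delay_nodes G B"
    and v: "v = index (Delay (j, i) l k)"
    by (auto elim: node_cases)
  from x have "i < n" using link_verts by auto
  show ?thesis
  proof (cases "u < n")
    case True
    then show ?thesis using kernel_to_index(1)[OF x] P_nonneg \<open>i < n\<close> v by auto
  next
    case False
    then have "u = n + (u - n)" "u - n < b" using assms by auto
    then show ?thesis using kernel_to_index(2)[OF x, of "u - n" t] v by auto
  qed
qed

text \<open>A compute node splits its mass as in \<open>P\<close>: each share goes either directly
  to its receiver or to the head of the one chain that the delay selects. A delay node passes
  everything to a single successor, the next node of its chain or, at the end, the receiver.\<close>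

lemma kernel_column_sum:
  assumes "u < N"
  shows "(\<Sum>v<N. kernel t v u) = 1"
proof (cases "u < n")
  case u: True
  let ?\<theta> = "\<lambda>i. \<tau> (Suc t) (u, i)"
  let ?g = "\<lambda>x. case x of Delay (j, i) l k \<Rightarrow>
        if j = u \<and> k = 1 \<and> \<tau> (Suc t) (j, i) = l \<and> l \<ge> 1 then P $$ (i, u) else 0"
  let ?S = "{i. i < n \<and> (u, i) \<in> links G \<and> ?\<theta> i \<ge> 1}"
  let ?D = "\<lambda>i. Delay (u, i) (?\<theta> i) 1"
  have "(\<Sum>r<b. kernel t (n + r) u) = sum ?g (delay_nodes G B)"
    using u by (simp add: kernel_delay_compute sum_delay_nodes)
  also have "\<dots> = sum ?g (?D ` ?S)"
  proof (rule sum.mono_neutral_right[OF finite_delay_nodes])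
    \<comment> \<open>The delay bound enters here: a chain as long as the current delay
      exists.\<close>
    show "?D ` ?S \<subseteq> delay_nodes G B"
      using delay_bound by auto
    show "\<forall>x\<in>delay_nodes G B - ?D ` ?S. ?g x = 0"
    proof
      fix x assume x: "x \<in> delay_nodes G B - ?D ` ?S"
      obtain j i l k where "x = Delay (j, i) l k"
        by (metis delay_node.exhaust prod.exhaust)
      with x link_verts show "?g x = 0"
        by (auto simp: image_iff)
    qed
  qed
  also have "\<dots> = (\<Sum>i\<in>?S. P $$ (i, u))"
    by (subst sum.reindex) (auto simp: inj_on_def)
  also have "\<dots> = (\<Sum>i<n. if (u, i) \<in> links G \<and> ?\<theta> i \<ge> 1 then P $$ (i, u) else 0)"
    by (rule sum.mono_neutral_cong_left) auto
  finally have "(\<Sum>v<N. kernel t v u) =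
      (\<Sum>i<n. kernel t i u + (if (u, i) \<in> links G \<and> ?\<theta> i \<ge> 1 then P $$ (i, u) else 0))"
    by (simp add: sum_lessThan_add sum.distrib)
  also have "\<dots> = (\<Sum>i<n. P $$ (i, u))"
    \<comment> \<open>For each receiver exactly one of the two summands carries the share, according
      to whether the delay is zero; off the links both the summands and \<open>P\<close> vanish,
      except on the diagonal.\<close>
    by (rule sum.cong) (use u link_verts P_not_link in \<open>auto simp: kernel_compute_compute\<close>)
  finally show ?thesis using P_column_sum[OF u] by simp
next
  case False
  define r where "r = u - n"
  have r: "r < b" "u = n + r" using False assms by (auto simp: r_def)
  obtain j i l k where x: "d r = Delay (j, i) l k"
    by (metis delay_node.exhaust prod.exhaust)
  with d_in_delay_nodes[OF r(1)] have dn: "(j, i) \<in> links G" "l \<le> B" "1 \<le> k" "k \<le> l" "i < n"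
    using link_verts by auto
  have "(\<Sum>v<n. kernel t v u) = (\<Sum>v<n. if i = v then (if k = l then 1 else 0) else 0)"
    using r x by (intro sum.cong) (auto simp: kernel_compute_delay)
  then have compute: "(\<Sum>v<n. kernel t v u) = (if k = l then 1 else 0)"
    using dn by simp
  have "(\<Sum>r'<b. kernel t (n + r') u) =
      (\<Sum>r'<b. if d r' = Delay (j, i) l (k + 1) then 1 else 0)"
    using r x by (intro sum.cong) (auto simp: kernel_delay_delay split: delay_node.splits)
  also have "\<dots> = (\<Sum>y\<in>delay_nodes G B. if y = Delay (j, i) l (k + 1) then 1 else 0)"
    by (rule sum_delay_nodes)
  also have "\<dots> = (if k = l then 0 else 1)"
    using dn finite_delay_nodes by auto
  finally show ?thesis
    using compute by (simp add: sum_lessThan_add)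
qed

section \<open>Solutions of the delayed iteration\<close>

text \<open>No sign or initial value is prescribed, so that linear combinations of the two Push-Sum
  sequences are again trajectories.\<close>

definition trajectory :: "(nat \<Rightarrow> nat \<Rightarrow> real) \<Rightarrow> bool" where
  "trajectory y \<longleftrightarrow> (\<forall>t. \<forall>v<N. y (Suc t) v = (\<Sum>u<N. kernel t v u * y t u))"

lemma trajectory_linear:
  assumes "trajectory y" "trajectory z"
  shows "trajectory (\<lambda>t v. c * y t v + c' * z t v)"
  using assms
  by (simp add: trajectory_def sum_distrib_left sum.distrib algebra_simps)

lemma trajectory_mass:
  assumes "trajectory y"
  shows "(\<Sum>v<N. y (t + s) v) = (\<Sum>v<N. y t v)"
proof (induction s)
  case (Suc s)
  have "(\<Sum>v<N. y (t + Suc s) v) = (\<Sum>v<N. \<Sum>u<N. kernel (t + s) v u * y (t + s) u)"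
    using assms by (simp add: trajectory_def)
  also have "\<dots> = (\<Sum>u<N. (\<Sum>v<N. kernel (t + s) v u) * y (t + s) u)"
    by (subst sum.swap) (simp add: sum_distrib_right)
  finally show ?case using Suc by (simp add: kernel_column_sum)
qed simp

lemma trajectory_nonneg:
  assumes "trajectory y" "\<And>v. v < N \<Longrightarrow> y t v \<ge> 0" "v < N"
  shows "y (t + s) v \<ge> 0"
  using assms(3)
proof (induction s arbitrary: v)
  case (Suc s)
  then show ?case using assms(1)
    by (auto simp: trajectory_def intro!: sum_nonneg mult_nonneg_nonneg kernel_nonneg)
qed (simp add: assms)

lemma trajectory_le_mass:
  assumes "trajectory y" "\<And>v. v < N \<Longrightarrow> y t v \<ge> 0" "v < N"
  shows "y (t + s) v \<le> (\<Sum>u<N. y t u)"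
proof -
  have "y (t + s) v \<le> (\<Sum>u<N. y (t + s) u)"
    using assms trajectory_nonneg[OF assms(1,2)] by (intro member_le_sum) auto
  then show ?thesis using trajectory_mass[OF assms(1)] by simp
qed

lemma trajectory_step_ge:
  assumes "trajectory y" "\<And>v. v < N \<Longrightarrow> y t v \<ge> 0" "u < N" "v < N"
  shows "kernel t v u * y t u \<le> y (Suc t) v"
proof -
  have "kernel t v u * y t u \<le> (\<Sum>u<N. kernel t v u * y t u)"
    using assms kernel_nonneg by (intro member_le_sum) auto
  then show ?thesis using assms by (simp add: trajectory_def)
qed

text \<open>A chain only shifts its contents, so its \<open>k\<close>-th node holds what entered the
  chain \<open>k\<close> steps earlier. The factor in front of \<open>y t j\<close> depends on the
  delays but not on \<open>y\<close>; this makes different trajectories comparable at delay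
  nodes.\<close>

lemma trajectory_delay_node:
  assumes "trajectory y" "(j, i) \<in> links G" "l \<le> B" "1 \<le> k" "k \<le> l"
  shows "y (t + k) (index (Delay (j, i) l k)) =
    (if \<tau> (Suc t) (j, i) = l then P $$ (i, j) else 0) * y t j"
  using assms(4,5)
proof (induction k rule: nat_induct_at_least)
  case base
  then have x: "Delay (j, i) l 1 \<in> delay_nodes G B" using assms by simp
  have "y (t + 1) (index (Delay (j, i) l 1)) =
      (\<Sum>u<N. kernel t (index (Delay (j, i) l 1)) u * y t u)"
    using assms(1) index_props(1)[OF x] by (simp add: trajectory_def)
  also have "\<dots> = (\<Sum>u<n. kernel t (index (Delay (j, i) l 1)) u * y t u)"
    using kernel_to_index(2)[OF x] by (simp add: sum_lessThan_add)
  also have "\<dots> = (\<Sum>u<n. if j = u then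
      (if \<tau> (Suc t) (j, i) = l then P $$ (i, j) else 0) * y t j else 0)"
    using kernel_to_index(1)[OF x] by (intro sum.cong) auto
  finally show ?case using link_verts[OF assms(2)] by simp
next
  case (Suc k)
  then have x: "Delay (j, i) l (Suc k) \<in> delay_nodes G B"
    and x': "Delay (j, i) l k \<in> delay_nodes G B"
    using assms by simp_all
  let ?v = "index (Delay (j, i) l (Suc k))"
  have "y (t + Suc k) ?v = (\<Sum>u<N. kernel (t + k) ?v u * y (t + k) u)"
    using assms(1) index_props(1)[OF x] by (simp add: trajectory_def)
  also have "\<dots> = (\<Sum>r<b. kernel (t + k) ?v (n + r) * y (t + k) (n + r))"
    using kernel_to_index(1)[OF x] Suc by (simp add: sum_lessThan_add)
  \<comment> \<open>The summand is rewritten as a function of \<open>d r\<close>, so that the sum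
    can be reindexed by delay nodes.\<close>
  also have "\<dots> = (\<Sum>r<b. (\<lambda>z. if z = Delay (j, i) l k then y (t + k) (index z) else 0) (d r))"
  proof (intro sum.cong)
    fix r assume "r \<in> {..<b}"
    then show "kernel (t + k) ?v (n + r) * y (t + k) (n + r) =
        (\<lambda>z. if z = Delay (j, i) l k then y (t + k) (index z) else 0) (d r)"
      using kernel_to_index(2)[OF x, of r "t + k"] Suc.hyps index_d[of r] by auto
  qed simp
  also have "\<dots> = y (t + k) (index (Delay (j, i) l k))"
    using x' finite_delay_nodes by (subst sum_delay_nodes) simp
  finally show ?case using Suc by simp
qed

section \<open>Uniform lower bounds on transported mass\<close>

text \<open>The smallest positive share, capped at 1 so that it also bounds from below the unit
  entries that move mass along and out of the chains.\<close>

definition \<eta> :: real where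
  "\<eta> = Min (insert 1 {P $$ (i, j) | i j. i < n \<and> j < n \<and> P $$ (i, j) > 0})"

lemma finite_positive_entries:
  "finite {P $$ (i, j) | i j. i < n \<and> j < n \<and> P $$ (i, j) > 0}"
proof -
  have "{P $$ (i, j) | i j. i < n \<and> j < n \<and> P $$ (i, j) > 0} \<subseteq> (\<lambda>(i, j). P $$ (i, j)) ` ({..<n} \<times> {..<n})"
    by auto
  then show ?thesis by (rule finite_subset) simp
qed

lemma \<eta>_pos: "\<eta> > 0"
  and \<eta>_le_1: "\<eta> \<le> 1"
  and \<eta>_le: "i < n \<Longrightarrow> j < n \<Longrightarrow> P $$ (i, j) > 0 \<Longrightarrow> \<eta> \<le> P $$ (i, j)"
proof -
  show "\<eta> > 0" unfolding \<eta>_def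
    by (subst Min_gr_iff) (use finite_positive_entries in auto)
  show "\<eta> \<le> 1" unfolding \<eta>_def
    by (rule Min_le) (use finite_positive_entries in auto)
  show "\<eta> \<le> P $$ (i, j)" if "i < n" "j < n" "P $$ (i, j) > 0" unfolding \<eta>_def
    by (rule Min_le) (use finite_positive_entries that in auto)
qed

text \<open>Replaces walks in a time-varying graph: the (\<open>v\<close>, \<open>u\<close>) entry
  of a product of \<open>T\<close> consecutive matrices is bounded below by
  \<open>\<eta> ^ T\<close>, tested on nonnegative trajectories. Quantifying over the starting time
  makes such bounds composable.\<close>

definition reach :: "nat \<Rightarrow> nat \<Rightarrow> nat \<Rightarrow> bool" where
  "reach T u v \<longleftrightarrow> (\<forall>y t. trajectory y \<longrightarrow> (\<forall>x<N. y t x \<ge> 0) \<longrightarrow> \<eta> ^ T * y t u \<le> y (t + T) v)"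

lemma reach_0: "reach 0 u u"
  by (simp add: reach_def)

lemma reach_trans:
  assumes "reach S u v" "reach T v w"
  shows "reach (S + T) u w"
  unfolding reach_def
proof (intro allI impI)
  fix y t assume y: "trajectory y" "\<forall>x<N. y t x \<ge> 0"
  have "\<eta> ^ (S + T) * y t u = \<eta> ^ T * (\<eta> ^ S * y t u)"
    by (simp add: power_add)
  also have "\<dots> \<le> \<eta> ^ T * y (t + S) v"
    using assms(1) y \<eta>_pos by (intro mult_left_mono) (auto simp: reach_def)
  also have "\<dots> \<le> y (t + S + T) w"
    using assms(2) y trajectory_nonneg[OF y(1), of t] by (auto simp: reach_def)
  finally show "\<eta> ^ (S + T) * y t u \<le> y (t + (S + T)) w"
    by (simp add: add.assoc)
qed

lemma reach_step:
  assumes "u < N" "v < N" "\<And>t. kernel t v u \<ge> \<eta>"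
  shows "reach 1 u v"
  unfolding reach_def
proof (intro allI impI)
  fix y t assume y: "trajectory y" "\<forall>x<N. y t x \<ge> 0"
  have "\<eta> * y t u \<le> kernel t v u * y t u"
    using assms y by (intro mult_right_mono) auto
  also have "\<dots> \<le> y (Suc t) v"
    using assms y by (intro trajectory_step_ge) auto
  finally show "\<eta> ^ 1 * y t u \<le> y (t + 1) v" by simp
qed

lemma reach_self: "v < n \<Longrightarrow> reach T v v"
proof (induction T)
  case (Suc T)
  have "reach 1 v v"
    using Suc.prems \<eta>_le[of v v] P_diag_pos[of v]
    by (intro reach_step) (simp_all add: kernel_compute_compute)
  from reach_trans[OF Suc.IH[OF Suc.prems] this] show ?case by simp
qed (rule reach_0)

text \<open>Mass can wait at \<open>v\<close> through the self-loop. Delay nodes have no self-loop,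
  hence the restriction on \<open>v\<close>.\<close>

lemma reach_mono:
  assumes "reach S u v" "v < n" "S \<le> T"
  shows "reach T u v"
  using reach_trans[OF assms(1) reach_self[OF assms(2), of "T - S"]] le_add_diff_inverse[OF assms(3)]
  by metis

text \<open>Mass inside a chain moves on with weight 1 whatever the current delays are:
  \<open>l - k\<close> steps to the end of the chain and one more to the receiver.\<close>

lemma reach_from_delay_node:
  assumes "k \<le> l" "(j, i) \<in> links G" "l \<le> B" "1 \<le> k"
  shows "reach (Suc (l - k)) (index (Delay (j, i) l k)) i"
  using assms(1,4)
proof (induction rule: inc_induct)
  case base
  then have x: "Delay (j, i) l l \<in> delay_nodes G B" using assms by simp
  have "kernel t i (index (Delay (j, i) l l)) = 1" for t
    using index_props[OF x] link_verts[OF assms(2)]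
      kernel_compute_delay[of i "index (Delay (j, i) l l) - n" t] by simp
  then have "reach 1 (index (Delay (j, i) l l)) i"
    using index_props[OF x] link_verts[OF assms(2)] \<eta>_le_1 by (intro reach_step) auto
  then show ?case by simp
next
  case (step k)
  then have x: "Delay (j, i) l k \<in> delay_nodes G B" and x': "Delay (j, i) l (Suc k) \<in> delay_nodes G B"
    using assms by simp_all
  have "kernel t (index (Delay (j, i) l (Suc k))) (index (Delay (j, i) l k)) = 1" for t
    using kernel_to_index(2)[OF x', of "index (Delay (j, i) l k) - n" t] index_props[OF x] step
    by simp
  then have "reach 1 (index (Delay (j, i) l k)) (index (Delay (j, i) l (Suc k)))"
    using index_props[OF x] index_props[OF x'] \<eta>_le_1 by (intro reach_step) auto
  from reach_trans[OF this step.IH] step show ?case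
    by (simp add: Suc_diff_Suc)
qed

text \<open>The route depends on the delay met at time \<open>t\<close>, but its duration can be
  made uniform: a message with delay \<open>l\<close> needs \<open>l + 1\<close> steps, and it waits
  at \<open>i\<close> for the other \<open>B - l\<close>.\<close>

lemma reach_link:
  assumes "(j, i) \<in> links G"
  shows "reach (B + 1) j i"
  unfolding reach_def
proof (intro allI impI)
  fix y t assume y: "trajectory y" "\<forall>x<N. y t x \<ge> 0"
  have ij: "j < n" "i < n" "j \<noteq> i" using link_verts[OF assms] by auto
  have \<eta>: "\<eta> \<le> P $$ (i, j)" using \<eta>_le ij P_link_pos assms by auto
  have nonneg: "\<forall>x<N. y (t + s) x \<ge> 0" for s
    using trajectory_nonneg[OF y(1), of t] y(2) by auto
  define l where "l = \<tau> (Suc t) (j, i)"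
  have l: "l \<le> B" using delay_bound assms by (simp add: l_def)
  \<comment> \<open>Here \<open>v\<close> is where the message sits after one step: at
    \<open>i\<close> itself if the delay is zero, otherwise at the head of the chain of length
    \<open>l\<close>.\<close>
  obtain v where v: "\<eta> * y t j \<le> y (t + 1) v" "reach B v i"
  proof (cases "l = 0")
    case True
    have "\<eta> * y t j \<le> kernel t i j * y t j"
      using True assms ij \<eta> y by (intro mult_right_mono) (auto simp: kernel_compute_compute l_def)
    also have "\<dots> \<le> y (Suc t) i"
      using ij y by (intro trajectory_step_ge) auto
    finally show thesis using that[of i] reach_self ij by simp
  next
    case False
    have "\<eta> * y t j \<le> P $$ (i, j) * y t j"
      using \<eta> ij y by (intro mult_right_mono) auto
    also have "\<dots> = y (t + 1) (index (Delay (j, i) l 1))"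
      using trajectory_delay_node[OF y(1) assms l, of 1 t] False by (simp add: l_def)
    finally have step: "\<eta> * y t j \<le> y (t + 1) (index (Delay (j, i) l 1))" .
    have "reach (Suc (l - 1)) (index (Delay (j, i) l 1)) i"
      using False assms l by (intro reach_from_delay_node) auto
    from reach_mono[OF this \<open>i < n\<close>, of B] have "reach B (index (Delay (j, i) l 1)) i"
      using l False by simp
    with step show thesis by (rule that)
  qed
  have "\<eta> ^ (B + 1) * y t j = \<eta> ^ B * (\<eta> * y t j)"
    by simp
  also have "\<dots> \<le> \<eta> ^ B * y (t + 1) v"
    using v(1) \<eta>_pos by (intro mult_left_mono) auto
  also have "\<dots> \<le> y (t + 1 + B) i"
    using v(2) y(1) nonneg[of 1] unfolding reach_def by blast
  finally show "\<eta> ^ (B + 1) * y t j \<le> y (t + (B + 1)) i"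
    by (simp add: add.assoc add.commute[of B 1])
qed

lemma ex_reach_compute:
  assumes "u < n" "v < n"
  shows "\<exists>T. reach T u v"
proof -
  have "u \<rightarrow>\<^sup>*\<^bsub>with_proj G\<^esub> v"
    using connected assms verts by (auto simp: strongly_connected_def)
  then have "(u, v) \<in> (parcs G)\<^sup>*"
    by (metis reachable_def rtrancl_on_rtranclI with_proj_simps(3))
  then show ?thesis
  proof (induction rule: rtrancl_induct)
    case base
    show ?case using reach_0 by blast
  next
    case (step w x)
    show ?case
    \<comment> \<open>The arc set may contain loops, which are not links; they leave the endpoint of
      the path unchanged.\<close>
    proof (cases "w = x")
      case False
      with step have "reach (B + 1) w x" by (intro reach_link) (simp add: links_def)
      with step.IH show ?thesis by (blast intro: reach_trans)
    qed (use step in simp)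
  qed
qed

lemma ex_reach:
  assumes "u < N" "v < n"
  shows "\<exists>T. reach T u v"
  using assms(1)
proof (cases rule: node_cases)
  case 1
  then show ?thesis using ex_reach_compute assms by blast
next
  case (2 j i l k)
  then have link: "(j, i) \<in> links G" "l \<le> B" "1 \<le> k" "k \<le> l" by simp_all
  then obtain T where "reach T i v" using ex_reach_compute[OF _ assms(2)] link_verts by blast
  from reach_trans[OF reach_from_delay_node[OF link(4,1,2,3)] this] 2 show ?thesis by blast
qed

lemma uniform_reach: "\<exists>T. \<forall>u<N. \<forall>v<n. reach T u v"
proof -
  obtain S where S: "\<And>u v. u < N \<Longrightarrow> v < n \<Longrightarrow> reach (S u v) u v"
    using ex_reach by metis
  \<comment> \<open>A crude common upper bound for the finitely many times \<open>S u v\<close>;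
    waiting at the target extends each of them to \<open>T\<close>.\<close>
  define T where "T = (\<Sum>u<N. \<Sum>v<n. S u v)"
  have "S u v \<le> T" if "u < N" "v < n" for u v
  proof -
    have "S u v \<le> (\<Sum>v<n. S u v)" using that by (intro member_le_sum) auto
    also have "\<dots> \<le> T" unfolding T_def
      using that by (intro member_le_sum[of u _ "\<lambda>u. \<Sum>v<n. S u v"]) auto
    finally show ?thesis .
  qed
  then show ?thesis using reach_mono[OF S] by (intro exI[of _ T]) auto
qed

section \<open>Contraction of the bound relative to the weights\<close>

text \<open>The fraction of the total mass guaranteed at a compute node. Dividing by
  \<open>N + 1\<close> instead of \<open>N\<close> keeps it strictly below 1, so that
  \<open>1 - rate T\<close> is positive and has a root that can serve as rate.\<close>

definition rate :: "nat \<Rightarrow> real" where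
  "rate T = \<eta> ^ T / real (N + 1)"

lemma rate_bounds: "0 < rate T" "rate T < 1"
proof -
  have "\<eta> ^ T \<le> 1" using \<eta>_pos \<eta>_le_1 by (simp add: power_le_one)
  then show "0 < rate T" "rate T < 1"
    using \<eta>_pos n_pos by (auto simp: rate_def)
qed

text \<open>The value at \<open>i\<close> is at least \<open>\<eta> ^ T\<close> times the value of
  every node \<open>T\<close> steps before, hence at least \<open>\<eta> ^ T\<close> times their
  average. The average is known because mass is conserved; the free offset \<open>s\<close> gives
  the bound at all later times too.\<close>

lemma compute_lower_bound:
  assumes T: "\<forall>u<N. \<forall>v<n. reach T u v"
    and y: "trajectory y" and y0: "\<And>x. x < N \<Longrightarrow> y t x \<ge> 0"
    and i: "i < n"
  shows "rate T * (\<Sum>x<N. y t x) \<le> y (t + s + T) i"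
proof -
  have y1: "y (t + s) x \<ge> 0" if "x < N" for x
    using trajectory_nonneg[OF y y0 that] .
  have ge: "\<eta> ^ T * y (t + s) x \<le> y (t + s + T) i" if "x < N" for x
    using T that i y y1 by (auto simp: reach_def)
  have "\<eta> ^ T * (\<Sum>x<N. y t x) = (\<Sum>x<N. \<eta> ^ T * y (t + s) x)"
    using trajectory_mass[OF y, of t s] by (simp flip: sum_distrib_left)
  also have "\<dots> \<le> real N * y (t + s + T) i"
    using sum_bounded_above[of "{..<N}" "\<lambda>x. \<eta> ^ T * y (t + s) x"] ge by simp
  also have "\<dots> \<le> real (N + 1) * y (t + s + T) i"
    using trajectory_nonneg[OF y y0, of i "s + T"] i
    by (intro mult_right_mono) (simp_all add: add.assoc)
  finally have "\<eta> ^ T * (\<Sum>x<N. y t x) \<le> real (N + 1) * y (t + s + T) i" .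
  then show ?thesis
    unfolding rate_def by (simp add: field_simps)
qed

text \<open>
  Both trajectories may vanish at a delay node. They are still comparable there, because both carry
  the same share \<open>p\<close> of the mass that their common source node held \<open>k\<close> steps before.
\<close>

lemma mass_lower_bound:
  assumes T: "\<forall>u<N. \<forall>v<n. reach T u v"
    and y: "trajectory y" and w: "trajectory w"
    and y0: "\<And>x. x < N \<Longrightarrow> y t x \<ge> 0" and w0: "\<And>x. x < N \<Longrightarrow> w t x \<ge> 0"
    and v: "v < N"
  shows "rate T * (\<Sum>x<N. y t x) * w (t + (T + B)) v \<le> (\<Sum>x<N. w t x) * y (t + (T + B)) v"
proof -
  let ?Y = "\<Sum>x<N. y t x" and ?W = "\<Sum>x<N. w t x"
  have Y: "?Y \<ge> 0" and W: "?W \<ge> 0" using y0 w0 by (auto intro!: sum_nonneg)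
  \<comment> \<open>At compute nodes \<open>w\<close> is at most its whole mass, while
    \<open>y\<close> is at least the guaranteed fraction of its own.\<close>
  have compute: "rate T * ?Y * w (t + s + T) i \<le> ?W * y (t + s + T) i" if i: "i < n" for s i
  proof -
    have "w (t + (s + T)) i \<le> ?W"
      using i by (intro trajectory_le_mass[OF w w0]) auto
    then have "rate T * ?Y * w (t + s + T) i \<le> rate T * ?Y * ?W"
      using rate_bounds(1)[of T] Y by (intro mult_left_mono) (auto simp: add.assoc)
    also have "\<dots> \<le> y (t + s + T) i * ?W"
      using compute_lower_bound[OF T y y0 i] W by (intro mult_right_mono) auto
    finally show ?thesis by (simp add: mult.commute)
  qed
  show ?thesis
    using v
  proof (cases rule: node_cases)
    case 1
    from compute[OF this, of B] show ?thesis by (simp add: ac_simps)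
  next
    case (2 j i l k)
    then have link: "(j, i) \<in> links G" "l \<le> B" "1 \<le> k" "k \<le> l" by auto
    \<comment> \<open>The time at which the mass now in \<open>v\<close> was still at
      \<open>j\<close>. Since \<open>k \<le> B\<close>, at least \<open>T\<close> steps have passed
      by then, so \<open>compute\<close> applies at \<open>j\<close>; this is why the block has
      length \<open>T + B\<close>.\<close>
    define s where "s = t + (B - k) + T"
    define p where "p = (if \<tau> (Suc s) (j, i) = l then P $$ (i, j) else 0)"
    have s: "t + (T + B) = s + k" using link by (simp add: s_def)
    have eq: "f (t + (T + B)) v = p * f s j" if "trajectory f" for f
      unfolding s p_def 2(2) by (rule trajectory_delay_node[OF that link])
    have p: "p \<ge> 0" using P_link_pos[OF link(1)] by (simp add: p_def)
    have "p * (rate T * ?Y * w s j) \<le> p * (?W * y s j)"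
      using compute[of j "B - k"] link_verts[OF link(1)] p
      by (intro mult_left_mono) (auto simp: s_def)
    then show ?thesis
      using eq[OF y] eq[OF w] by (simp add: ac_simps)
  qed
qed

text \<open>\<open>mass_lower_bound\<close> is applied to \<open>D * w + z\<close> and
  \<open>D * w - z\<close>. Because \<open>z\<close> has total mass zero, both have mass
  \<open>D\<close> times that of \<open>w\<close>, and this mass cancels at the end.\<close>

lemma contraction:
  assumes T: "\<forall>u<N. \<forall>v<n. reach T u v"
    and z: "trajectory z" and w: "trajectory w"
    and z_mass: "(\<Sum>x<N. z t x) = 0" and w_mass: "(\<Sum>x<N. w t x) > 0"
    and w0: "\<And>x. x < N \<Longrightarrow> w t x \<ge> 0" and zw: "\<And>x. x < N \<Longrightarrow> \<bar>z t x\<bar> \<le> D * w t x"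
    and v: "v < N"
  shows "\<bar>z (t + (T + B)) v\<bar> \<le> (1 - rate T) * D * w (t + (T + B)) v"
proof -
  let ?s = "t + (T + B)"
  have signed: "rate T * D * w ?s v \<le> D * w ?s v + c * z ?s v"
    if c: "c = 1 \<or> c = -1" for c
  proof -
    let ?W = "\<Sum>x<N. w t x"
    have "D * w t x + c * z t x \<ge> 0" if "x < N" for x
      using zw[OF that] c by auto
    from mass_lower_bound[OF T trajectory_linear[OF w z] w this w0 v]
    have "rate T * (\<Sum>x<N. D * w t x + c * z t x) * w ?s v \<le> ?W * (D * w ?s v + c * z ?s v)" .
    moreover have "(\<Sum>x<N. D * w t x + c * z t x) = D * ?W"
      using z_mass by (simp add: sum.distrib flip: sum_distrib_left)
    ultimately have "?W * (rate T * D * w ?s v) \<le> ?W * (D * w ?s v + c * z ?s v)"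
      by (simp add: ac_simps)
    then show ?thesis using w_mass by simp
  qed
  show ?thesis
    using signed[of 1] signed[of "-1"] by (simp add: algebra_simps abs_le_iff)
qed

text \<open>Nonnegativity of \<open>D * w + z\<close> and \<open>D * w - z\<close> is inherited by
  later times. This covers the steps left over after the last full block.\<close>

lemma domination_preserved:
  assumes "trajectory z" "trajectory w" "\<And>x. x < N \<Longrightarrow> \<bar>z t x\<bar> \<le> D * w t x" "v < N"
  shows "\<bar>z (t + s) v\<bar> \<le> D * w (t + s) v"
proof -
  have "0 \<le> D * w (t + s) v + 1 * z (t + s) v"
    by (rule trajectory_nonneg[OF trajectory_linear[OF assms(2,1)] _ assms(4)])
      (use assms(3) in force)
  moreover have "0 \<le> D * w (t + s) v + (-1) * z (t + s) v"
    by (rule trajectory_nonneg[OF trajectory_linear[OF assms(2,1)] _ assms(4)])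
      (use assms(3) in force)
  ultimately show ?thesis by simp
qed

lemma geometric_domination:
  assumes B: "B \<ge> 1"
    and z: "trajectory z" and w: "trajectory w"
    and z_mass: "(\<Sum>x<N. z 0 x) = 0" and w_mass: "(\<Sum>x<N. w 0 x) > 0"
    and w0: "\<And>x. x < N \<Longrightarrow> w 0 x \<ge> 0" and D: "D \<ge> 0"
    and zw: "\<And>x. x < N \<Longrightarrow> \<bar>z 0 x\<bar> \<le> D * w 0 x"
  shows "\<exists>C \<rho>. C \<ge> 0 \<and> 0 < \<rho> \<and> \<rho> < 1 \<and> (\<forall>t. \<forall>v<N. \<bar>z t v\<bar> \<le> C * \<rho> ^ t * w t v)"
proof -
  obtain T where T: "\<forall>u<N. \<forall>v<n. reach T u v"
    using uniform_reach by blast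
  define q where "q = 1 - rate T"
  define S where "S = T + B"
  obtain C \<rho> where C: "C \<ge> 0" "0 < \<rho>" "\<rho> < 1" "\<And>t. q ^ (t div S) \<le> C * \<rho> ^ t"
    using div_power_le_geometric[of q S] rate_bounds[of T] B by (auto simp: q_def S_def)
  have w_nonneg: "w s x \<ge> 0" if "x < N" for s x
    using trajectory_nonneg[OF w w0 that, of s] by simp
  have blocks: "\<bar>z (k * S) x\<bar> \<le> q ^ k * D * w (k * S) x" if "x < N" for k x
    using that
  proof (induction k arbitrary: x)
    case (Suc k)
    \<comment> \<open>The contraction is restarted at time \<open>k * S\<close>; its conditions on
      total mass persist by mass conservation.\<close>
    have "\<bar>z (k * S + (T + B)) x\<bar> \<le> (1 - rate T) * (q ^ k * D) * w (k * S + (T + B)) x"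
      using z_mass w_mass trajectory_mass[OF z, of 0 "k * S"] trajectory_mass[OF w, of 0 "k * S"]
      by (intro contraction[OF T z w _ _ w_nonneg Suc.IH Suc.prems]) auto
    then show ?case by (simp add: q_def S_def ac_simps)
  qed (simp add: zw)
  have "\<bar>z t v\<bar> \<le> (D * C) * \<rho> ^ t * w t v" if v: "v < N" for t v
  proof -
    from domination_preserved[OF z w blocks v, of "t div S" "t mod S"]
    have "\<bar>z t v\<bar> \<le> q ^ (t div S) * D * w t v"
      by simp
    also have "\<dots> \<le> C * \<rho> ^ t * D * w t v"
      using C(4) D w_nonneg[OF v] by (intro mult_right_mono) auto
    finally show ?thesis by (simp add: ac_simps)
  qed
  then show ?thesis
    using C D by (intro exI[of _ "D * C"] exI[of _ \<rho>]) auto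
qed

section \<open>From trajectories back to the estimates\<close>

text \<open>Makes the denominators of the estimates positive: a compute node always keeps a positive
  share of its own mass.\<close>

lemma trajectory_compute_pos:
  assumes "trajectory w" "\<And>x. x < N \<Longrightarrow> w 0 x \<ge> 0" "i < n" "w 0 i > 0"
  shows "w t i > 0"
proof -
  have "\<eta> ^ t * w 0 i \<le> w t i"
    using reach_self[OF assms(3), of t] assms unfolding reach_def by (metis add_0)
  then show ?thesis
    using assms(4) \<eta>_pos by (smt (verit) mult_pos_pos zero_less_power)
qed

lemma trajectory_iterate:
  assumes "x \<in> carrier_vec N"
  shows "trajectory (\<lambda>t v. iterate (\<lambda>t. delay_mat n G P B d (\<tau> t)) x t $ v)"
proof -
  let ?x = "iterate (\<lambda>t. delay_mat n G P B d (\<tau> t)) x"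
  have dim: "?x t \<in> carrier_vec N" for t
    by (induction t) (use assms delay_mat_dims in \<open>auto intro!: mult_mat_vec_carrier\<close>)
  show ?thesis
    unfolding trajectory_def
  proof (intro allI impI)
    fix t v assume v: "v < N"
    have dims: "dim_row (delay_mat n G P B d (\<tau> (Suc t))) = N"
      "dim_col (delay_mat n G P B d (\<tau> (Suc t))) = N" "dim_vec (?x t) = N"
      using delay_mat_dims[of "\<tau> (Suc t)"] dim[of t] by auto
    show "?x (Suc t) $ v = (\<Sum>u<N. kernel t v u * ?x t $ u)"
      using v dims by (simp add: scalar_prod_def kernel_def atLeast0LessThan)
  qed
qed

end

theorem theorem3:
  fixes n B :: nat
    and G :: "nat pair_pre_digraph"
    and P :: "real mat"
    and d :: "nat \<Rightarrow> delay_node"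
    and \<tau> :: "nat \<Rightarrow> nat \<times> nat \<Rightarrow> nat"
    and x0 :: "real vec"
  assumes "pair_fin_digraph G" and "pverts G = {..<n}"
    and "strongly_connected (with_proj G)"
    and "column_stochastic_protocol n P G"
    and "B \<ge> 1"
    and "bij_betw d {..<num_delay_nodes G B} (delay_nodes G B)"
    and "\<And>t e. t \<ge> 1 \<Longrightarrow> e \<in> links G \<Longrightarrow> \<tau> t e \<le> B"
    and "x0 \<in> carrier_vec n"
  shows "\<exists>C0 \<rho>. C0 \<ge> 0 \<and> 0 < \<rho> \<and> \<rho> < 1 \<and>
    (\<forall>t. \<forall>i<n.
       \<bar>estimate n (num_delay_nodes G B) (\<lambda>t. delay_mat n G P B d (\<tau> t)) x0 t i
          - (\<Sum>j<n. x0 $ j) / real n\<bar> \<le> C0 * \<rho> ^ t)"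
proof -
  interpret delayed_push_sum n B G P d \<tau>
    by (intro delayed_push_sum.intro assms)
  define a where "a = (\<Sum>j<n. x0 $ j) / real n"
  define s where
    "s t v = iterate (\<lambda>t. delay_mat n G P B d (\<tau> t)) (x0 @\<^sub>v 0\<^sub>v b) t $ v" for t v
  define w where
    "w t v = iterate (\<lambda>t. delay_mat n G P B d (\<tau> t)) (vec n (\<lambda>_. 1) @\<^sub>v 0\<^sub>v b) t $ v" for t v
  \<comment> \<open>The error before normalisation. The masses of \<open>s\<close> and
    \<open>w\<close> are the sum of \<open>x0\<close> and \<open>n\<close>, so subtracting
    \<open>a * w\<close> makes the total mass of \<open>z\<close> zero.\<close>
  define z where "z t v = 1 * s t v + (- a) * w t v" for t v
  \<comment> \<open>A crude bound on every \<open>\<bar>x0 $ j - a\<bar>\<close>. Initially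
    \<open>w\<close> is 1 on compute nodes, and at delay nodes both \<open>z\<close> and
    \<open>w\<close> start at 0.\<close>
  define D where "D = (\<Sum>j<n. \<bar>x0 $ j\<bar>) + \<bar>a\<bar>"
  have s_traj: "trajectory s"
    unfolding s_def using assms(8) by (intro trajectory_iterate) simp
  have w_traj: "trajectory w"
    unfolding w_def by (intro trajectory_iterate) simp
  have z_traj: "trajectory z"
    unfolding z_def by (rule trajectory_linear[OF s_traj w_traj])
  have s0: "s 0 v = (if v < n then x0 $ v else 0)" if "v < N" for v
    using that assms(8) by (auto simp: s_def)
  have w0: "w 0 v = (if v < n then 1 else 0)" if "v < N" for v
    using that by (auto simp: w_def)
  have s_mass: "(\<Sum>x<N. s 0 x) = (\<Sum>j<n. x0 $ j)" and w_mass: "(\<Sum>x<N. w 0 x) = real n"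
    by (simp_all add: sum_lessThan_add s0 w0)
  have z_mass: "(\<Sum>x<N. z 0 x) = 0"
  proof -
    have "(\<Sum>x<N. z 0 x) = (\<Sum>x<N. s 0 x) - a * (\<Sum>x<N. w 0 x)"
      by (simp add: z_def sum_subtractf sum_distrib_left)
    then show ?thesis using n_pos by (simp add: s_mass w_mass a_def)
  qed
  have D: "D \<ge> 0" by (simp add: D_def sum_nonneg)
  have z0: "\<bar>z 0 x\<bar> \<le> D * w 0 x" if x: "x < N" for x
  proof (cases "x < n")
    case True
    have "\<bar>x0 $ x\<bar> \<le> (\<Sum>j<n. \<bar>x0 $ j\<bar>)"
      using True by (intro member_le_sum) auto
    then show ?thesis using True x by (simp add: z_def s0 w0 D_def)
  qed (use x in \<open>simp add: z_def s0 w0\<close>)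
  have w_mass_pos: "(\<Sum>x<N. w 0 x) > 0" using n_pos by (simp add: w_mass)
  have w_nonneg: "w 0 x \<ge> 0" if "x < N" for x
    using w0[OF that] by simp
  obtain C \<rho> where C: "C \<ge> 0" "0 < \<rho>" "\<rho> < 1"
    and dom: "\<And>t v. v < N \<Longrightarrow> \<bar>z t v\<bar> \<le> C * \<rho> ^ t * w t v"
    using geometric_domination[OF assms(5) z_traj w_traj z_mass w_mass_pos w_nonneg D z0] by auto
  have "\<bar>estimate n b (\<lambda>t. delay_mat n G P B d (\<tau> t)) x0 t i - a\<bar> \<le> C * \<rho> ^ t"
    if i: "i < n" for t i
  proof -
    have w_pos: "w t i > 0"
      by (rule trajectory_compute_pos[OF w_traj w_nonneg i]) (use i w0[of i] in simp_all)
    \<comment> \<open>Dividing by \<open>w\<close> turns domination of \<open>z\<close> relative to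
      \<open>w\<close> into the error bound, with the same constants for all compute nodes.\<close>
    have "estimate n b (\<lambda>t. delay_mat n G P B d (\<tau> t)) x0 t i - a = z t i / w t i"
      using w_pos by (simp add: estimate_def s_def[symmetric] w_def[symmetric] z_def field_simps)
    moreover have "\<bar>z t i\<bar> \<le> C * \<rho> ^ t * w t i"
      using i by (intro dom) simp
    ultimately show ?thesis
      using w_pos by (simp add: abs_div_pos[symmetric] pos_divide_le_eq)
  qed
  then show ?thesis
    using C unfolding a_def by blast
qed

end
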